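(* Let \[ \mathcal{I}:=\{\alpha\in (1,\infty)\mid (\lfloor\alpha^{2^n}\rfloor)_{n=1}^\infty\text{ is a Type 2 irrationality sequence}\}. \] Then the complement $(1,\infty)\setminus \mathcal{I}$ is countable.
   Context: For sequences of real numbers $(x_n)_{n=1}^\infty$, $(y_n)_{n=1}^\infty$ with $y_n>0$, write $x_n\approx y_n$ if $\lim_{n\to\infty}x_n/y_n=1$. A (weakly) increasing sequence of positive integers $a_1\leq a_2\leq a_3\leq\cdots$ is called a Type 2 irrationality sequence if for every sequence of positive integers $(b_n)_{n=1}^\infty$ such that $a_n\approx b_n$, we have $\sum_{n=1}^\infty \frac{1}{b_n}\notin\mathbb{Q}$. "Countable" means finite or countably infinite. *)

theory Defs
  imports "HOL-Analysis.Analysis"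
begin

text \<open>
  Sequences are indexed from 1: a sequence is a function on \<^typ>\<open>nat\<close> whose value at 0 is
  ignored, so the series over all indices from 1 on is the series of \<open>\<lambda>n. 1 / b (Suc n)\<close>.
  Convergence is stated explicitly, since \<^const>\<open>suminf\<close> is meaningful only for summable
  sequences; a divergent series does not count as having an irrational sum.
\<close>

definition type2_irrationality_sequence :: "(nat \<Rightarrow> int) \<Rightarrow> bool" where
  "type2_irrationality_sequence a \<longleftrightarrow>
     (\<forall>n\<ge>1. a n > 0) \<and> mono_on {1..} a \<and>
     (\<forall>b :: nat \<Rightarrow> int.
        (\<forall>n\<ge>1. b n > 0) \<longrightarrow>
        (\<lambda>n. real_of_int (a n) / real_of_int (b n)) \<longlonglongrightarrow> 1 \<longrightarrow>
        summable (\<lambda>n. 1 / real_of_int (b (Suc n))) \<and>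
        (\<Sum>n. 1 / real_of_int (b (Suc n))) \<notin> \<rat>)"

definition type2_bases :: "real set" where
  "type2_bases =
     {\<alpha> \<in> {1<..}. type2_irrationality_sequence (\<lambda>n. \<lfloor>\<alpha> ^ (2 ^ n)\<rfloor>)}"

end

theory Submission
  imports Defs
begin

text \<open>
  Let \<open>c\<close> be a sequence of positive integers with \<open>c n / \<alpha> ^ 2 ^ Suc n \<longlonglongrightarrow> 1\<close> whose reciprocals
  have a rational sum, and write the tails of the series as \<open>p n / q n\<close> with
  \<open>q (Suc n) = q n * c n\<close> and \<open>p (Suc n) = p n * c n - q n\<close>. Since \<open>c (Suc n) / (c n)\<^sup>2 \<longlonglongrightarrow> 1\<close>,
  the integers \<open>p n\<close> satisfy \<open>p (Suc n) / p n \<longlonglongrightarrow> 1\<close>, so eventually \<open>p (Suc n)\<close> lies in the open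
  interval from \<open>p n / 2\<close> to \<open>3 * p n / 2\<close>, which has length \<open>p n\<close>. As \<open>p (Suc n)\<close> is also
  congruent to \<open>- q n\<close> modulo \<open>p n\<close>, it is determined by \<open>p n\<close> and \<open>q n\<close>, and then so is \<open>c n\<close>.
  Hence \<open>\<alpha>\<close> is determined by some triple \<open>(N, p N, q N)\<close>, of which there are countably many.
\<close>

section \<open>Tails of fast-converging series\<close>

text \<open>Eventually each term is at most half its predecessor, so comparison with a geometric
  series bounds a tail by twice its first term. What follows \<open>f n\<close> in its tail is then
  at most \<open>2 * f (Suc n)\<close>, negligible against \<open>f n\<close>.\<close>

lemma suminf_tail_asymp:
  fixes f :: "nat \<Rightarrow> real"
  assumes pos: "\<And>n. 0 < f n" and lim: "(\<lambda>n. f (Suc n) / f n) \<longlonglongrightarrow> 0"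
  shows "summable f" and "(\<lambda>n. (\<Sum>k. f (k + n)) / f n) \<longlonglongrightarrow> 1"
proof -
  have "eventually (\<lambda>n. f (Suc n) / f n < 1 / 2) sequentially"
    using lim by (rule order_tendstoD) simp
  then obtain N where N: "\<And>n. n \<ge> N \<Longrightarrow> f (Suc n) / f n < 1 / 2"
    by (auto simp: eventually_sequentially)
  have half: "f (Suc n) \<le> 1 / 2 * f n" if "n \<ge> N" for n
    using N[OF that] pos[of n] by (simp add: field_simps)
  show summ: "summable f"
    by (rule summable_ratio_test[of "1 / 2" N]) (use half pos in \<open>auto simp: less_imp_le abs_of_pos\<close>)
  then have summ_tail: "summable (\<lambda>k. f (k + n))" for n
    by (simp add: summable_iff_shift)
  have tail_le: "(\<Sum>k. f (k + n)) \<le> 2 * f n" if "n \<ge> N" for n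
  proof -
    have "f (k + n) \<le> (1 / 2) ^ k * f n" for k
    proof (induction k)
      case (Suc k)
      then show ?case using half[of "k + n"] that by simp
    qed simp
    moreover have "(\<lambda>k. (1 / 2) ^ k * f n) sums (1 / (1 - 1 / 2) * f n)"
      by (intro sums_mult2 geometric_sums) simp
    ultimately show ?thesis
      using sums_le[OF _ summable_sums[OF summ_tail]] by fastforce
  qed
  have split: "(\<Sum>k. f (k + n)) = f n + (\<Sum>k. f (k + Suc n))" for n
    using suminf_split_head[OF summ_tail, of n] by simp
  have tail_nonneg: "0 \<le> (\<Sum>k. f (k + n))" for n
    using pos by (intro suminf_nonneg summ_tail less_imp_le)
  show "(\<lambda>n. (\<Sum>k. f (k + n)) / f n) \<longlonglongrightarrow> 1"
  proof (rule tendsto_sandwich)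
    show "eventually (\<lambda>n. 1 \<le> (\<Sum>k. f (k + n)) / f n) sequentially"
    proof (intro always_eventually allI)
      fix n
      show "1 \<le> (\<Sum>k. f (k + n)) / f n"
        using pos[of n] split[of n] tail_nonneg[of "Suc n"] by (simp add: le_divide_eq)
    qed
    show "eventually (\<lambda>n. (\<Sum>k. f (k + n)) / f n \<le> 1 + 2 * (f (Suc n) / f n)) sequentially"
      unfolding eventually_sequentially
    proof (intro exI allI impI)
      fix n assume "n \<ge> N"
      then have "(\<Sum>k. f (k + n)) \<le> f n + 2 * f (Suc n)"
        using tail_le[of "Suc n"] split[of n] by simp
      then show "(\<Sum>k. f (k + n)) / f n \<le> 1 + 2 * (f (Suc n) / f n)"
        using pos[of n] by (simp add: field_simps)
    qed
    show "(\<lambda>n. 1 + 2 * (f (Suc n) / f n)) \<longlonglongrightarrow> 1"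
      using tendsto_add[OF tendsto_const tendsto_mult[OF tendsto_const lim], of 1 2] by simp
  qed auto
qed

section \<open>Asymptotics of double powers\<close>

lemma inverse_double_power_tendsto_0:
  fixes x :: real
  assumes "1 < x"
  shows "(\<lambda>n. inverse (x ^ 2 ^ n)) \<longlonglongrightarrow> 0"
  using LIMSEQ_subseq_LIMSEQ[OF LIMSEQ_inverse_realpow_zero[OF assms], of "\<lambda>n. 2 ^ n"]
  by (simp add: o_def strict_mono_def)

lemma floor_quotient_tendsto_1:
  fixes x :: "nat \<Rightarrow> real"
  assumes ge1: "\<And>n. 1 \<le> x n" and lim: "(\<lambda>n. inverse (x n)) \<longlonglongrightarrow> 0"
  shows "(\<lambda>n. of_int \<lfloor>x n\<rfloor> / x n) \<longlonglongrightarrow> 1"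
proof (rule tendsto_sandwich)
  show "(\<lambda>n. 1 - inverse (x n)) \<longlonglongrightarrow> 1"
    using tendsto_diff[OF tendsto_const lim, of 1] by simp
  show "eventually (\<lambda>n. 1 - inverse (x n) \<le> of_int \<lfloor>x n\<rfloor> / x n) sequentially"
  proof (intro always_eventually allI)
    fix n
    have "1 - inverse (x n) = (x n - 1) / x n"
      using ge1[of n] by (simp add: diff_divide_distrib inverse_eq_divide)
    also have "\<dots> \<le> of_int \<lfloor>x n\<rfloor> / x n"
      using ge1[of n] by (intro divide_right_mono) linarith+
    finally show "1 - inverse (x n) \<le> of_int \<lfloor>x n\<rfloor> / x n" .
  qed
  show "eventually (\<lambda>n. of_int \<lfloor>x n\<rfloor> / x n \<le> 1) sequentially"
  proof (intro always_eventually allI)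
    fix n
    show "of_int \<lfloor>x n\<rfloor> / x n \<le> 1"
      using ge1[of n] by (simp add: field_simps)
  qed
qed auto

text \<open>Recovers the base from any tail of the sequence. If \<open>v < u\<close>, dividing the
  two limits makes \<open>(u / v) ^ 2 ^ Suc n\<close> tend to 1, although it stays at least
  \<open>u / v > 1\<close>.\<close>

lemma double_power_asymp_unique:
  fixes x y :: real
  assumes "1 < x" "1 < y"
    and x: "(\<lambda>n. c n / x ^ 2 ^ Suc n) \<longlonglongrightarrow> 1" and y: "(\<lambda>n. d n / y ^ 2 ^ Suc n) \<longlonglongrightarrow> 1"
    and eq: "eventually (\<lambda>n. c n = d n) sequentially"
  shows "x = y"
proof -
  have not_less: "\<not> v < u"
    if "1 < u" "1 < v" and u: "(\<lambda>n. c n / u ^ 2 ^ Suc n) \<longlonglongrightarrow> 1"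
      and v: "(\<lambda>n. d n / v ^ 2 ^ Suc n) \<longlonglongrightarrow> 1"
      and eq: "eventually (\<lambda>n. c n = d n) sequentially"
    for u v :: real and c d :: "nat \<Rightarrow> real"
  proof
    assume "v < u"
    have "(\<lambda>n. (d n / v ^ 2 ^ Suc n) / (c n / u ^ 2 ^ Suc n)) \<longlonglongrightarrow> 1"
      using tendsto_divide[OF v u] by simp
    \<comment> \<open>The limit of \<open>c n / u ^ 2 ^ Suc n\<close> is positive, so eventually
      \<open>c n\<close> is nonzero and cancels.\<close>
    moreover have "eventually (\<lambda>n. (d n / v ^ 2 ^ Suc n) / (c n / u ^ 2 ^ Suc n)
        = (u / v) ^ 2 ^ Suc n) sequentially"
      using eq order_tendstoD(1)[OF u zero_less_one]
      by eventually_elim (auto simp: power_divide)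
    ultimately have "(\<lambda>n. (u / v) ^ 2 ^ Suc n) \<longlonglongrightarrow> 1"
      by (rule Lim_transform_eventually)
    moreover have "u / v \<le> (u / v) ^ 2 ^ Suc n" for n
      using \<open>v < u\<close> \<open>1 < v\<close> by (intro self_le_power) auto
    ultimately have "u / v \<le> 1"
      by (intro LIMSEQ_le_const) auto
    with \<open>v < u\<close> \<open>1 < v\<close> show False by (simp add: field_simps)
  qed
  show ?thesis
    using not_less[OF assms(1,2) x y eq]
      not_less[OF assms(2,1) y x] eq by (force simp: eq_commute)
qed

section \<open>Integer recursion for the tails\<close>

text \<open>\<open>p n / q n\<close> plays the role of the \<open>n\<close>-th tail of the series of the reciprocals of \<open>c\<close>.\<close>

definition tail_fractions :: "nat \<Rightarrow> (nat \<Rightarrow> int) \<Rightarrow> (nat \<Rightarrow> int) \<Rightarrow> (nat \<Rightarrow> int) \<Rightarrow> bool" where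
  "tail_fractions N p q c \<longleftrightarrow>
     (\<forall>n\<ge>N. 0 < p n \<and> p (Suc n) = p n * c n - q n \<and> q (Suc n) = q n * c n \<and>
        p n < 2 * p (Suc n) \<and> 2 * p (Suc n) < 3 * p n)"

lemma tail_fractions_unique:
  assumes "tail_fractions N p q c" "tail_fractions N p' q' c'"
    and init: "p N = p' N" "q N = q' N"
    and "n \<ge> N"
  shows "c n = c' n"
proof -
  have step: "p (Suc n) = p' (Suc n) \<and> c n = c' n \<and> q (Suc n) = q' (Suc n)"
    if "n \<ge> N" and eq: "p n = p' n" "q n = q' n" for n
  proof -
    have t: "0 < p n" "p (Suc n) = p n * c n - q n" "q (Suc n) = q n * c n"
      "p n < 2 * p (Suc n)" "2 * p (Suc n) < 3 * p n"
      "p' (Suc n) = p n * c' n - q n" "q' (Suc n) = q n * c' n"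
      "p n < 2 * p' (Suc n)" "2 * p' (Suc n) < 3 * p n"
      using assms(1,2) that unfolding tail_fractions_def by auto
    \<comment> \<open>Both successors lie strictly between \<open>p n / 2\<close> and
      \<open>3 * p n / 2\<close>, so their difference, a multiple of \<open>p n\<close>, is smaller
      than \<open>p n\<close> and vanishes.\<close>
    have "p n * (c n - c' n) = p (Suc n) - p' (Suc n)"
      using t by (simp add: algebra_simps)
    then have "\<bar>p (Suc n) - p' (Suc n)\<bar> < p n" "p n dvd p (Suc n) - p' (Suc n)"
      using t by (auto intro: dvdI[OF sym])
    then have "p (Suc n) = p' (Suc n)"
      using zdvd_imp_le[of "p n" "\<bar>p (Suc n) - p' (Suc n)\<bar>"] by fastforce
    with t show ?thesis by auto
  qed
  have "p n = p' n \<and> q n = q' n"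
    using \<open>n \<ge> N\<close> by (induction n rule: dec_induct) (use init step in auto)
  with step \<open>n \<ge> N\<close> show ?thesis by blast
qed

text \<open>Squaring \<open>\<alpha> ^ 2 ^ Suc n\<close> gives the next double power, so
  \<open>(c n)\<^sup>2\<close> and \<open>c (Suc n)\<close> have the same asymptotics. The second
  limit is the first times that of \<open>inverse (c n)\<close>.\<close>

lemma double_power_asymp_growth:
  fixes c :: "nat \<Rightarrow> real"
  assumes "1 < \<alpha>" and pos: "\<And>n. 0 < c n"
    and lim: "(\<lambda>n. c n / \<alpha> ^ 2 ^ Suc n) \<longlonglongrightarrow> 1"
  shows "(\<lambda>n. (c n)\<^sup>2 / c (Suc n)) \<longlonglongrightarrow> 1" and "(\<lambda>n. c n / c (Suc n)) \<longlonglongrightarrow> 0"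
proof -
  have sq: "(\<alpha> ^ 2 ^ Suc n)\<^sup>2 = \<alpha> ^ 2 ^ Suc (Suc n)" for n
    by (simp add: power_mult[symmetric] mult.commute)
  have nz: "c n \<noteq> 0" "\<alpha> \<noteq> 0" for n
    using pos[of n] \<open>1 < \<alpha>\<close> by auto
  have "(\<lambda>n. (c n / \<alpha> ^ 2 ^ Suc n)\<^sup>2 / (c (Suc n) / \<alpha> ^ 2 ^ Suc (Suc n))) \<longlonglongrightarrow> 1\<^sup>2 / 1"
    by (intro tendsto_divide tendsto_power lim LIMSEQ_Suc[OF lim]) auto
  moreover have "(c n / \<alpha> ^ 2 ^ Suc n)\<^sup>2 / (c (Suc n) / \<alpha> ^ 2 ^ Suc (Suc n)) = (c n)\<^sup>2 / c (Suc n)" for n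
    unfolding power_divide sq using nz by (simp del: power_Suc)
  ultimately show ratio: "(\<lambda>n. (c n)\<^sup>2 / c (Suc n)) \<longlonglongrightarrow> 1"
    by (simp only: one_power2 div_by_1)
  have "(\<lambda>n. inverse (\<alpha> ^ 2 ^ Suc n) / (c n / \<alpha> ^ 2 ^ Suc n)) \<longlonglongrightarrow> 0 / 1"
    by (intro tendsto_divide lim LIMSEQ_Suc[OF inverse_double_power_tendsto_0] \<open>1 < \<alpha>\<close>) auto
  moreover have "inverse (\<alpha> ^ 2 ^ Suc n) / (c n / \<alpha> ^ 2 ^ Suc n) = inverse (c n)" for n
    using nz by (simp del: power_Suc add: field_simps)
  ultimately have "(\<lambda>n. inverse (c n)) \<longlonglongrightarrow> 0" by simp
  from tendsto_mult[OF ratio this]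
  have "(\<lambda>n. (c n)\<^sup>2 / c (Suc n) * inverse (c n)) \<longlonglongrightarrow> 0" by simp
  then show "(\<lambda>n. c n / c (Suc n)) \<longlonglongrightarrow> 0"
    using nz by (simp add: power2_eq_square field_simps)
qed

text \<open>The tail \<open>r n\<close> is asymptotic to \<open>1 / c n\<close>, and
  \<open>p (Suc n) / p n = c n * r (Suc n) / r n\<close>. Hence this quotient has the same limit as
  \<open>(c n)\<^sup>2 / c (Suc n)\<close>.\<close>

lemma rational_sum_tail_fractions:
  fixes c :: "nat \<Rightarrow> int"
  assumes pos: "\<And>n. 0 < c n"
    and ratio: "(\<lambda>n. (real_of_int (c n))\<^sup>2 / real_of_int (c (Suc n))) \<longlonglongrightarrow> 1"
    and growth: "(\<lambda>n. real_of_int (c n) / real_of_int (c (Suc n))) \<longlonglongrightarrow> 0"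
    and rat: "(\<Sum>n. 1 / real_of_int (c n)) \<in> \<rat>"
  shows "\<exists>N p q. tail_fractions N p q c"
proof -
  define f where "f n = 1 / real_of_int (c n)" for n
  define r where "r n = (\<Sum>k. f (k + n))" for n
  have f_pos: "0 < f n" for n
    using pos by (simp add: f_def)
  have "(\<lambda>n. f (Suc n) / f n) \<longlonglongrightarrow> 0"
    using growth by (simp add: f_def)
  from suminf_tail_asymp[OF f_pos this]
  have summ: "summable f" and tail: "(\<lambda>n. r n / f n) \<longlonglongrightarrow> 1"
    by (simp_all add: r_def)
  have summ_tail: "summable (\<lambda>k. f (k + n))" for n
    using summ by (simp add: summable_iff_shift)
  have r_Suc: "r (Suc n) = r n - f n" for n
    using suminf_split_head[OF summ_tail, of n] by (simp add: r_def)
  have r_pos: "0 < r n" for n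
    unfolding r_def by (intro suminf_pos summ_tail f_pos)
  obtain P Q :: int where PQ: "Q > 0" "r 0 = of_int P / of_int Q"
    using rat by (auto simp: r_def f_def elim: Rats_cases')
  \<comment> \<open>\<open>q n\<close> is a common denominator of the full sum and the first
    \<open>n\<close> terms, hence of \<open>r n\<close>. The recursion makes \<open>p n\<close> an
    integer by construction; \<open>p_eq\<close> identifies it with
    \<open>r n * q n\<close>.\<close>
  define q where "q n = Q * (\<Prod>k<n. c k)" for n
  define p where "p = rec_nat P (\<lambda>n x. x * c n - q n)"
  have q_Suc: "q (Suc n) = q n * c n" for n
    by (simp add: q_def)
  have p_Suc: "p (Suc n) = p n * c n - q n" for n
    by (simp add: p_def)
  have q_pos: "0 < q n" for n
    using PQ pos by (simp add: q_def prod_pos)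
  have p_eq: "of_int (p n) = r n * of_int (q n)" for n
  proof (induction n)
    case 0
    then show ?case using PQ by (simp add: p_def q_def)
  next
    case (Suc n)
    then show ?case
      using pos[of n] by (simp add: p_Suc q_Suc r_Suc f_def algebra_simps)
  qed
  have p_pos: "0 < p n" for n
    using p_eq[of n] r_pos[of n] q_pos[of n] by (metis mult_pos_pos of_int_0_less_iff)
  have "(\<lambda>n. r (Suc n) / f (Suc n) / (r n / f n) *
      ((real_of_int (c n))\<^sup>2 / real_of_int (c (Suc n)))) \<longlonglongrightarrow> 1 / 1 * 1"
    by (intro tendsto_mult tendsto_divide ratio tail LIMSEQ_Suc[OF tail]) auto
  moreover have "r (Suc n) / f (Suc n) / (r n / f n) *
      ((real_of_int (c n))\<^sup>2 / real_of_int (c (Suc n))) = of_int (p (Suc n)) / of_int (p n)" for n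
    using pos[of n] pos[of "Suc n"] r_pos[of n] q_pos[of n]
    unfolding p_eq f_def q_Suc by (simp add: field_simps power2_eq_square)
  ultimately have lim: "(\<lambda>n. real_of_int (p (Suc n)) / real_of_int (p n)) \<longlonglongrightarrow> 1"
    by simp
  have "eventually (\<lambda>n. 1 / 2 < real_of_int (p (Suc n)) / real_of_int (p n) \<and>
      real_of_int (p (Suc n)) / real_of_int (p n) < 3 / 2) sequentially"
    by (intro eventually_conj order_tendstoD[OF lim]) auto
  then obtain N where N: "\<And>n. n \<ge> N \<Longrightarrow> 1 / 2 < real_of_int (p (Suc n)) / real_of_int (p n) \<and>
      real_of_int (p (Suc n)) / real_of_int (p n) < 3 / 2"
    by (auto simp: eventually_sequentially)
  have "p n < 2 * p (Suc n) \<and> 2 * p (Suc n) < 3 * p n" if "n \<ge> N" for n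
  proof -
    have "real_of_int (p n) < real_of_int (2 * p (Suc n))"
      "real_of_int (2 * p (Suc n)) < real_of_int (3 * p n)"
      using N[OF that] p_pos[of n] by (simp_all add: field_simps)
    then show ?thesis by linarith
  qed
  then have "tail_fractions N p q c"
    using p_pos p_Suc q_Suc by (simp add: tail_fractions_def)
  then show ?thesis by blast
qed

section \<open>Exceptional bases and countability\<close>

text \<open>The floors are positive and increasing for every base, so failure comes from some
  \<open>b\<close>. Its growth rules out divergence, which leaves a rational sum.\<close>

lemma not_type2_base_tail_fractions:
  assumes "\<alpha> \<in> {1<..} - type2_bases"
  shows "\<exists>N p q c. tail_fractions N p q c \<and>
    (\<lambda>n. real_of_int (c n) / \<alpha> ^ 2 ^ Suc n) \<longlonglongrightarrow> 1"
proof -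
  define a where "a = (\<lambda>n. \<lfloor>\<alpha> ^ 2 ^ n\<rfloor>)"
  have "1 < \<alpha>" and not_type2: "\<not> type2_irrationality_sequence a"
    using assms by (auto simp: type2_bases_def a_def)
  have ge1: "1 \<le> \<alpha> ^ n" for n
    using \<open>1 < \<alpha>\<close> by (simp add: one_le_power)
  have a_pos: "0 < a n" for n
    using ge1[of "2 ^ n"] unfolding a_def by linarith
  have "mono_on {1..} a"
    using \<open>1 < \<alpha>\<close> by (auto simp: a_def intro!: mono_onI floor_mono power_increasing)
  with not_type2 a_pos obtain b :: "nat \<Rightarrow> int" where b_pos: "\<forall>n\<ge>1. b n > 0"
    and lim: "(\<lambda>n. real_of_int (a n) / real_of_int (b n)) \<longlonglongrightarrow> 1"
    and rat: "summable (\<lambda>n. 1 / real_of_int (b (Suc n))) \<Longrightarrow>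
      (\<Sum>n. 1 / real_of_int (b (Suc n))) \<in> \<rat>"
    unfolding type2_irrationality_sequence_def by blast
  \<comment> \<open>The shift starts the series at index 0; hence the exponent
    \<open>2 ^ Suc n\<close> in the limits for \<open>c\<close>.\<close>
  define c where "c n = b (Suc n)" for n
  have c_pos: "0 < c n" for n
    using b_pos by (simp add: c_def)
  have floor_lim: "(\<lambda>n. real_of_int (a n) / \<alpha> ^ 2 ^ n) \<longlonglongrightarrow> 1"
    unfolding a_def
    by (intro floor_quotient_tendsto_1 ge1 inverse_double_power_tendsto_0 \<open>1 < \<alpha>\<close>)
  have "(\<lambda>n. (real_of_int (a n) / \<alpha> ^ 2 ^ n) / (real_of_int (a n) / real_of_int (b n))) \<longlonglongrightarrow> 1 / 1"
    by (intro tendsto_divide lim floor_lim) auto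
  \<comment> \<open>This holds even at \<open>n = 0\<close>, where \<open>b 0\<close> is
    unconstrained: if \<open>b 0 = 0\<close>, both sides are 0 by the convention for division by
    zero.\<close>
  moreover have "(real_of_int (a n) / \<alpha> ^ 2 ^ n) / (real_of_int (a n) / real_of_int (b n))
      = real_of_int (b n) / \<alpha> ^ 2 ^ n" for n
    using a_pos[of n] by simp
  ultimately have "(\<lambda>n. real_of_int (b n) / \<alpha> ^ 2 ^ n) \<longlonglongrightarrow> 1"
    by simp
  then have c_lim: "(\<lambda>n. real_of_int (c n) / \<alpha> ^ 2 ^ Suc n) \<longlonglongrightarrow> 1"
    unfolding c_def by (rule LIMSEQ_Suc)
  have ratio: "(\<lambda>n. (real_of_int (c n))\<^sup>2 / real_of_int (c (Suc n))) \<longlonglongrightarrow> 1"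
    and growth: "(\<lambda>n. real_of_int (c n) / real_of_int (c (Suc n))) \<longlonglongrightarrow> 0"
    using double_power_asymp_growth[OF \<open>1 < \<alpha>\<close> _ c_lim] c_pos by simp_all
  have "summable (\<lambda>n. 1 / real_of_int (c n))"
    by (rule suminf_tail_asymp(1)) (use c_pos growth in simp_all)
  then have "(\<Sum>n. 1 / real_of_int (c n)) \<in> \<rat>"
    using rat by (simp add: c_def)
  with rational_sum_tail_fractions[OF c_pos ratio growth] c_lim show ?thesis
    by blast
qed

theorem theorem4:
  shows "countable ({1<..} - type2_bases)"
proof -
  \<comment> \<open>A base may have many codes, but each code belongs to at most one base.\<close>
  define coded where "coded \<alpha> t \<longleftrightarrow> (\<exists>N p q c. t = (N, p N, q N) \<and> tail_fractions N p q c \<and>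
      (\<lambda>n. real_of_int (c n) / \<alpha> ^ 2 ^ Suc n) \<longlonglongrightarrow> 1)"
    for \<alpha> :: real and t :: "nat \<times> int \<times> int"
  have ex: "\<exists>t. coded \<alpha> t" if "\<alpha> \<in> {1<..} - type2_bases" for \<alpha>
    using not_type2_base_tail_fractions[OF that] unfolding coded_def by blast
  have uniq: "\<alpha> = \<beta>" if gt1: "1 < \<alpha>" "1 < \<beta>" and "coded \<alpha> t" "coded \<beta> t" for \<alpha> \<beta> t
  proof -
    obtain N p q c where c: "t = (N, p N, q N)" "tail_fractions N p q c"
      "(\<lambda>n. real_of_int (c n) / \<alpha> ^ 2 ^ Suc n) \<longlonglongrightarrow> 1"
      using \<open>coded \<alpha> t\<close> unfolding coded_def by blast
    obtain N' p' q' c' where c': "t = (N', p' N', q' N')" "tail_fractions N' p' q' c'"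
      "(\<lambda>n. real_of_int (c' n) / \<beta> ^ 2 ^ Suc n) \<longlonglongrightarrow> 1"
      using \<open>coded \<beta> t\<close> unfolding coded_def by blast
    have "tail_fractions N p' q' c'" "p N = p' N" "q N = q' N"
      using c(1) c'(1,2) by auto
    then have "eventually (\<lambda>n. real_of_int (c n) = real_of_int (c' n)) sequentially"
      using tail_fractions_unique[OF c(2)] by (intro eventually_sequentiallyI[of N]) simp
    with double_power_asymp_unique[OF gt1 c(3) c'(3)] show ?thesis .
  qed
  \<comment> \<open>Choosing one code per base gives an injection into a countable type.\<close>
  have "inj_on (\<lambda>\<alpha>. SOME t. coded \<alpha> t) ({1<..} - type2_bases)"
  proof (rule inj_onI)
    fix \<alpha> \<beta> assume mem: "\<alpha> \<in> {1<..} - type2_bases" "\<beta> \<in> {1<..} - type2_bases"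
      and "(SOME t. coded \<alpha> t) = (SOME t. coded \<beta> t)"
    then show "\<alpha> = \<beta>"
      using uniq[of \<alpha> \<beta>] someI_ex[OF ex[OF mem(1)]] someI_ex[OF ex[OF mem(2)]] by auto
  qed
  then show ?thesis by (rule countableI')
qed

end
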